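(* Every connected $3P_2$-free graph $G$ has a longest path that is dominating, i.e., there is a path $P$ of maximum length in $G$ such that every vertex of $G$ not on $P$ has a neighbor on $P$.
   Context: All graphs are finite and simple. $3P_2$ is the disjoint union of three copies of the path on two vertices (an induced matching of size three). A graph is $3P_2$-free if it has no induced subgraph isomorphic to $3P_2$. *)

theory Defs
  imports "Graph_Theory.Graph_Theory"
begin

text \<open>
  A finite simple graph is a \<open>graph\<close> in the sense of the library: a finite loop-free symmetric
  digraph without parallel arcs, each undirected edge being a pair of opposite arcs.  The library's
  \<open>connected\<close> excludes the null graph, and a \<open>vpath\<close> is nonempty.
\<close>

definition path_graph :: "nat \<Rightarrow> nat pair_pre_digraph" where
  "path_graph n = \<lparr> pverts = {..<n},
     parcs = {(i, j). i < n \<and> j < n \<and> (j = Suc i \<or> i = Suc j)} \<rparr>"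

definition disjoint_copies :: "nat \<Rightarrow> 'a pair_pre_digraph \<Rightarrow> (nat \<times> 'a) pair_pre_digraph" where
  "disjoint_copies k H = \<lparr> pverts = {..<k} \<times> pverts H,
     parcs = {((i, u), (i, v)) | i u v. i < k \<and> (u, v) \<in> parcs H} \<rparr>"

definition induced_free :: "('a, 'b) pre_digraph \<Rightarrow> ('c, 'd) pre_digraph \<Rightarrow> bool" where
  "induced_free H G \<longleftrightarrow> \<not> (\<exists>K. induced_subgraph K G \<and> digraph_iso K H)"

definition longest_path :: "'a vwalk \<Rightarrow> ('a, 'b) pre_digraph \<Rightarrow> bool" where
  "longest_path p G \<longleftrightarrow>
     vpath p G \<and> (\<forall>q. vpath q G \<longrightarrow> vwalk_length q \<le> vwalk_length p)"

definition dominating :: "'a set \<Rightarrow> ('a, 'b) pre_digraph \<Rightarrow> bool" where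
  "dominating D G \<longleftrightarrow> (\<forall>v \<in> verts G - D. \<exists>u \<in> D. v \<rightarrow>\<^bsub>G\<^esub> u)"

lemma pair_graph_path_graph: "pair_graph (path_graph n)"
proof
  show "finite (parcs (path_graph n))"
    by (rule finite_subset[of _ "{..<n} \<times> {..<n}"]) (auto simp: path_graph_def)
qed (auto simp: path_graph_def symmetric_def sym_def)

lemma pair_graph_disjoint_copies:
  assumes "pair_graph H"
  shows "pair_graph (disjoint_copies k H)"
proof -
  interpret pair_graph H by (rule assms)
  have "symmetric (with_proj H)"
    by (rule pair_sym_arcs)
  then have sym: "(v, u) \<in> parcs H" if "(u, v) \<in> parcs H" for u v
    using that by (auto simp: symmetric_def sym_def)
  show ?thesis
  proof
    show "finite (parcs (disjoint_copies k H))"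
      by (rule finite_subset[of _ "({..<k} \<times> pverts H) \<times> ({..<k} \<times> pverts H)"])
        (auto simp: disjoint_copies_def pair_finite_verts dest: in_arcsD1 in_arcsD2)
  qed (auto simp: disjoint_copies_def symmetric_def sym_def pair_finite_verts
      dest: in_arcsD1 in_arcsD2 sym pair_no_loops)
qed

end

theory Submission
  imports Defs
begin

unbundle no funcset_syntax

text \<open>
  Let \<open>P\<close> be a longest path that does not dominate \<open>G\<close>.  By connectivity there are adjacent vertices
  \<open>x\<close>, \<open>y\<close> off \<open>P\<close> such that \<open>x\<close> has no neighbour on \<open>P\<close> and \<open>y\<close> has a neighbour \<open>v\<close> on \<open>P\<close>.  As \<open>P\<close>
  is longest, \<open>P = a b L v R c d\<close>, and \<open>y\<close> is adjacent to none of \<open>a\<close>, \<open>b\<close>, \<open>c\<close>, \<open>d\<close>.  The edges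
  \<open>xy\<close>, \<open>ab\<close>, \<open>cd\<close> do not form an induced matching, and each of the edges \<open>ac\<close>, \<open>ad\<close>, \<open>bd\<close> would
  close a cycle that extends to a longer path; so \<open>b\<close> and \<open>c\<close> are adjacent.  Then
  \<open>Q = x y v R c b L\<close> is a path as long as \<open>P\<close>.  If \<open>z\<close> were not dominated by \<open>Q\<close> and \<open>w\<close> were a
  neighbour of \<open>z\<close>, then \<open>xy\<close>, \<open>zw\<close>, \<open>ab\<close> would form an induced matching, because any further edge
  would lengthen \<open>P\<close> or \<open>Q\<close>.  Hence \<open>Q\<close> is dominating.
\<close>

section \<open>Paths and longest paths as vertex lists\<close>

lemma vpath_iff_successively:
  "vpath p G \<longleftrightarrow>
     p \<noteq> [] \<and> distinct p \<and> set p \<subseteq> verts G \<and> successively (\<lambda>u v. u \<rightarrow>\<^bsub>G\<^esub> v) p"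
proof -
  have "set (vwalk_arcs p) \<subseteq> arcs_ends G \<longleftrightarrow> successively (\<lambda>u v. u \<rightarrow>\<^bsub>G\<^esub> v) p"
    by (induction p rule: vwalk_arcs.induct) auto
  then show ?thesis
    by (auto simp: vpath_def vwalk_def)
qed

lemma vpath_append_iff:
  assumes "p \<noteq> []" "q \<noteq> []"
  shows "vpath (p @ q) G \<longleftrightarrow>
    vpath p G \<and> vpath q G \<and> last p \<rightarrow>\<^bsub>G\<^esub> hd q \<and> set p \<inter> set q = {}"
  using assms by (auto simp: vpath_iff_successively successively_append_iff)

lemma (in wf_digraph) vpath_Cons_iff:
  assumes "p \<noteq> []"
  shows "vpath (u # p) G \<longleftrightarrow> vpath p G \<and> u \<rightarrow> hd p \<and> u \<notin> set p"
  using assms by (auto simp: vpath_iff_successively successively_Cons intro: adj_in_verts)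

text \<open>Reversal lets every fact about the beginning of a longest path be reused at its
  end.\<close>

lemma (in sym_digraph) vpath_rev: "vpath (rev p) G \<longleftrightarrow> vpath p G"
proof -
  have "(\<lambda>u v. v \<rightarrow> u) = (\<lambda>u v. u \<rightarrow> v)"
    using arcs_ends_symmetric[OF sym_arcs] by blast
  then have "successively (\<lambda>u v. v \<rightarrow> u) p \<longleftrightarrow> successively (\<lambda>u v. u \<rightarrow> v) p"
    by (rule arg_cong)
  then show ?thesis
    by (simp add: vpath_iff_successively)
qed

lemma (in fin_digraph) longest_path_exists:
  assumes "verts G \<noteq> {}"
  shows "\<exists>p. longest_path p G"
proof -
  obtain v where v: "v \<in> verts G"
    using assms by auto
  show ?thesis
    unfolding longest_path_def
  proof (rule ex_has_greatest_nat)
    show "vpath [v] G"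
      using v by (simp add: vpath_iff_successively)
    show "\<forall>q. vpath q G \<longrightarrow> vwalk_length q < Suc (card (verts G))"
    proof (intro allI impI)
      fix q assume "vpath q G"
      then show "vwalk_length q < Suc (card (verts G))"
        using card_mono[of "verts G" "set q"] by (auto simp: vpath_iff_successively distinct_card)
    qed
  qed
qed

lemma longest_path_length_ge:
  assumes "longest_path p G" "vpath q G"
  shows "length q \<le> length p"
proof -
  \<comment> \<open>\<open>vwalk_length\<close> is the list length minus 1, truncated at 0; the
    bound carries over to list lengths only because \<open>p\<close> is nonempty.\<close>
  have "p \<noteq> []"
    using assms(1) by (simp add: longest_path_def vpath_iff_successively)
  moreover have "length q - 1 \<le> length p - 1"
    using assms by (simp add: longest_path_def)
  ultimately show ?thesis
    by (cases p) auto
qed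

text \<open>Otherwise \<open>r # p\<close> would be a longer path.\<close>

lemma (in wf_digraph) longest_path_hd_free:
  assumes "longest_path p G" "r \<notin> set p"
  shows "\<not> r \<rightarrow> hd p"
proof
  assume "r \<rightarrow> hd p"
  moreover have "vpath p G"
    using assms(1) by (simp add: longest_path_def)
  moreover from this have "p \<noteq> []"
    by (simp add: vpath_iff_successively)
  ultimately have "vpath (r # p) G"
    using assms(2) by (simp add: vpath_Cons_iff)
  then show False
    using longest_path_length_ge[OF assms(1)] by force
qed

text \<open>Otherwise \<open>s # r # p\<close> would be a path, and it trades the single vertex
  \<open>a\<close> for two.\<close>

lemma (in digraph) longest_path_second_free:
  assumes "longest_path (a # p) G" "p \<noteq> []" "r \<notin> set p" "s \<notin> set p" "s \<rightarrow> r"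
  shows "\<not> r \<rightarrow> hd p"
proof
  assume "r \<rightarrow> hd p"
  moreover have "vpath p G"
    using assms(1,2) by (simp add: longest_path_def vpath_Cons_iff)
  moreover have "s \<noteq> r"
    using assms(5) adj_not_same by blast
  ultimately have "vpath (s # r # p) G"
    using assms by (simp add: vpath_Cons_iff)
  then show False
    using longest_path_length_ge[OF assms(1)] by force
qed

section \<open>Certifying an induced copy\<close>

lemma not_induced_freeI:
  assumes "nomulti_digraph G" and "pair_wf_digraph H"
    and inj: "inj_on g (pverts H)" and sub: "g ` pverts H \<subseteq> verts G"
    and adj: "\<And>u v. \<lbrakk>u \<in> pverts H; v \<in> pverts H\<rbrakk> \<Longrightarrow> g u \<rightarrow>\<^bsub>G\<^esub> g v \<longleftrightarrow> (u, v) \<in> parcs H"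
  shows "\<not> induced_free (with_proj H) G"
proof -
  interpret nomulti_digraph G by fact
  interpret H: pair_wf_digraph H by fact
  \<comment> \<open>The isomorphism in \<open>induced_free\<close> goes from the subgraph of
    \<open>G\<close> to \<open>H\<close>, so it is built from the inverse of the embedding
    \<open>g\<close>.\<close>
  define f where "f = the_inv_into (pverts H) g"
  have fg: "f (g u) = u" if "u \<in> pverts H" for u
    using inj that by (simp add: f_def the_inv_into_f_f)
  let ?K = "G \<restriction> (g ` pverts H)"
  let ?h = "\<lparr>iso_verts = f, iso_arcs = (\<lambda>e. (f (tail G e), f (head G e))), iso_head = snd,
    iso_tail = fst\<rparr>"
  have ind: "induced_subgraph ?K G"
    using sub by (rule induced_induce)
  have iso: "pre_digraph.digraph_isomorphism ?K ?h"
    unfolding pre_digraph.digraph_isomorphism_def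
  proof (intro conjI)
    show "wf_digraph ?K"
      by (rule wellformed_induce_subgraph)
    show "inj_on (iso_verts ?h) (verts ?K)"
      by (auto simp: inj_on_def fg)
    \<comment> \<open>Arcs with the same image have the same ends, and \<open>G\<close> has no
      parallel arcs.\<close>
    show "inj_on (iso_arcs ?h) (arcs ?K)"
      by (auto simp: inj_on_def fg arc_to_ends_def intro: no_multi_arcs)
  qed simp
  have "parcs H \<subseteq> (\<lambda>e. (f (tail G e), f (head G e))) ` arcs ?K"
  proof
    fix a assume "a \<in> parcs H"
    then obtain u v where a: "a = (u, v)" "u \<in> pverts H" "v \<in> pverts H" "(u, v) \<in> parcs H"
      by (cases a) (auto dest: H.in_arcsD1 H.in_arcsD2)
    then obtain e where "e \<in> arcs G" "tail G e = g u" "head G e = g v"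
      using adj[of u v] by (auto simp: arcs_ends_conv)
    then show "a \<in> (\<lambda>e. (f (tail G e), f (head G e))) ` arcs ?K"
      using a by (intro image_eqI[of _ _ e]) (auto simp: fg)
  qed
  moreover have "(f (tail G e), f (head G e)) \<in> parcs H" if e: "e \<in> arcs ?K" for e
  proof -
    obtain u v where "u \<in> pverts H" "v \<in> pverts H" "tail G e = g u" "head G e = g v"
      using e by auto
    moreover have "tail G e \<rightarrow>\<^bsub>G\<^esub> head G e"
      using e by (auto simp: arcs_ends_conv)
    ultimately show ?thesis
      using adj by (simp add: fg)
  qed
  ultimately have "(\<lambda>e. (f (tail G e), f (head G e))) ` arcs ?K = parcs H"
    by blast
  moreover have "f ` g ` pverts H = pverts H"
    by (force simp: fg image_iff)
  ultimately have "with_proj H = app_iso ?h ?K"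
    by (simp add: app_iso_def with_proj_def)
  with ind iso show ?thesis
    unfolding induced_free_def digraph_iso_def by blast
qed

lemma (in graph) not_induced_free_three_edges:
  assumes edges: "a \<rightarrow> b" "c \<rightarrow> d" "e \<rightarrow> f"
    and cross: "\<And>s t. \<lbrakk>s \<in> {a, b}; t \<in> {c, d}\<rbrakk> \<Longrightarrow> \<not> s \<rightarrow> t"
      "\<And>s t. \<lbrakk>s \<in> {a, b}; t \<in> {e, f}\<rbrakk> \<Longrightarrow> \<not> s \<rightarrow> t"
      "\<And>s t. \<lbrakk>s \<in> {c, d}; t \<in> {e, f}\<rbrakk> \<Longrightarrow> \<not> s \<rightarrow> t"
  shows "\<not> induced_free (with_proj (disjoint_copies 3 (path_graph 2))) G"
proof -
  let ?H = "disjoint_copies 3 (path_graph 2)"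
  note sym = arcs_ends_symmetric[OF sym_arcs]
  have rev: "b \<rightarrow> a" "d \<rightarrow> c" "f \<rightarrow> e"
    using edges by (auto intro: sym)
  have loop: "\<not> s \<rightarrow> s" for s
    using adj_not_same by blast
  have non: "\<not> a \<rightarrow> c" "\<not> a \<rightarrow> d" "\<not> b \<rightarrow> c" "\<not> b \<rightarrow> d" "\<not> a \<rightarrow> e" "\<not> a \<rightarrow> f"
    "\<not> b \<rightarrow> e" "\<not> b \<rightarrow> f" "\<not> c \<rightarrow> e" "\<not> c \<rightarrow> f" "\<not> d \<rightarrow> e" "\<not> d \<rightarrow> f"
    by (simp_all add: cross)
  then have non': "\<not> c \<rightarrow> a" "\<not> d \<rightarrow> a" "\<not> c \<rightarrow> b" "\<not> d \<rightarrow> b" "\<not> e \<rightarrow> a" "\<not> f \<rightarrow> a"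
    "\<not> e \<rightarrow> b" "\<not> f \<rightarrow> b" "\<not> e \<rightarrow> c" "\<not> f \<rightarrow> c" "\<not> e \<rightarrow> d" "\<not> f \<rightarrow> d"
    by (blast dest: sym)+
  \<comment> \<open>The ends of one edge differ since there are no loops. A vertex shared by two of
    the edges would be adjacent to its partner in one of them, a forbidden cross adjacency.\<close>
  have dist: "distinct [a, b, c, d, e, f]"
    using edges rev non loop by auto
  define g where "g = (\<lambda>(i, j). [[a, b], [c, d], [e, f]] ! i ! j :: 'a)"
  have V: "pverts ?H = {(0, 0), (0, 1), (1, 0), (1, 1), (2, 0), (2, 1)}"
    by (auto simp: disjoint_copies_def path_graph_def)
  have A: "parcs ?H = {((i, j), (i, k)) | i j k. i < 3 \<and> j < 2 \<and> k < 2 \<and> j \<noteq> k}"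
    by (auto simp: disjoint_copies_def path_graph_def)
  have H: "pair_wf_digraph ?H"
    using pair_graph_disjoint_copies[OF pair_graph_path_graph]
    by (simp add: pair_graph_def pair_digraph_def pair_fin_digraph_def)
  show ?thesis
  proof (rule not_induced_freeI[OF nomulti_digraph H, of g])
    show "inj_on g (pverts ?H)"
      using dist unfolding V by (auto simp: g_def inj_on_def)
    show "g ` pverts ?H \<subseteq> verts G"
      using edges unfolding V by (auto simp: g_def intro: adj_in_verts)
    show "g u \<rightarrow> g v \<longleftrightarrow> (u, v) \<in> parcs ?H" if "u \<in> pverts ?H" "v \<in> pverts ?H" for u v
      using that edges rev loop non non' unfolding V A by (auto simp: g_def)
  qed
qed

section \<open>An edge leaving the closed neighbourhood\<close>

lemma (in graph) not_dominating_obtain: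
  assumes "Digraph_Component.connected G" and "D \<subseteq> verts G" and "D \<noteq> {}"
    and "\<not> dominating D G"
  obtains x y v where "x \<notin> D" "y \<notin> D" "v \<in> D" "x \<rightarrow> y" "y \<rightarrow> v" "\<And>u. u \<in> D \<Longrightarrow> \<not> x \<rightarrow> u"
proof -
  note sym = arcs_ends_symmetric[OF sym_arcs]
  \<comment> \<open>A walk from \<open>D\<close> to an undominated vertex leaves the closed
    neighbourhood \<open>?S\<close> along some arc from \<open>y\<close> to \<open>x\<close>. Here
    \<open>y\<close> is not in \<open>D\<close>, as otherwise \<open>x\<close> would be in
    \<open>?S\<close>.\<close>
  let ?S = "D \<union> {u. \<exists>v\<in>D. u \<rightarrow> v}"
  obtain s t where st: "s \<in> D" "t \<in> verts G" "t \<notin> ?S"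
    using assms unfolding dominating_def by blast
  have "strongly_connected G"
    using assms(1) sym_arcs by (metis symmetric_connected_imp_strongly_connected)
  then have "s \<rightarrow>\<^sup>* t"
    using st assms(2) by (auto simp: strongly_connected_def)
  then have "t \<in> ?S" if "\<And>x y. \<lbrakk>y \<in> ?S; y \<rightarrow> x\<rbrakk> \<Longrightarrow> x \<in> ?S"
    using st(1) that by (induction rule: reachable_induct) blast+
  then obtain x y where xy: "y \<in> ?S" "y \<rightarrow> x" "x \<notin> ?S"
    using st by blast
  then have "x \<rightarrow> y"
    by (blast intro: sym)
  with xy that show thesis
    by blast
qed

section \<open>Rerouting a longest path\<close>

lemma (in graph) dominating_longest_path_exists:
  assumes "Digraph_Component.connected G"
    and "induced_free (with_proj (disjoint_copies 3 (path_graph 2))) G"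
  shows "\<exists>p. longest_path p G \<and> dominating (set p) G"
proof -
  note sym = arcs_ends_symmetric[OF sym_arcs]
  have "verts G \<noteq> {}"
    using assms(1) by (auto simp: connected_def strongly_connected_def)
  then obtain P where P: "longest_path P G"
    using longest_path_exists by blast
  then have vP: "vpath P G"
    by (simp add: longest_path_def)
  have rev_P: "longest_path (rev P) G"
    using P by (simp add: longest_path_def vpath_rev)
  note P_max = longest_path_length_ge[OF P]
  show ?thesis
  proof (cases "dominating (set P) G")
    case False
    have "set P \<subseteq> verts G" "set P \<noteq> {}"
      using vP by (auto simp: vpath_iff_successively)
    then obtain x y v where xyv: "x \<notin> set P" "y \<notin> set P" "v \<in> set P" "x \<rightarrow> y" "y \<rightarrow> v"
      and x: "\<And>u. u \<in> set P \<Longrightarrow> \<not> x \<rightarrow> u"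
      using False not_dominating_obtain[OF assms(1)] by metis
    have "x \<noteq> y"
      using xyv(4) adj_not_same by blast
    have y_path: "vpath (y # v # q) G" and xy_path: "vpath (x # y # v # q) G"
      if "vpath (v # q) G" "set (v # q) \<subseteq> set P" for q
      using that xyv \<open>x \<noteq> y\<close> by (auto simp: vpath_Cons_iff)
    \<comment> \<open>Replacing a shorter \<open>A\<close> by \<open>x\<close>, \<open>y\<close>
      would give a path longer than \<open>P\<close>. The general form covers both \<open>P\<close>
      and \<open>rev P\<close>.\<close>
    have two_before: "2 \<le> length A"
      if "vpath (A @ v # B) G" "set (A @ v # B) \<subseteq> set P" "length P = length (A @ v # B)" for A B
    proof -
      have "vpath (v # B) G"
        using that(1) by (cases "A = []") (auto simp: vpath_append_iff)
      then have "vpath (x # y # v # B) G"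
        using that(2) by (intro xy_path) auto
      from P_max[OF this] show ?thesis
        using that(3) by simp
    qed
    obtain A B where AB: "P = A @ v # B"
      using xyv(3) by (auto dest: split_list)
    have "2 \<le> length A"
      using two_before[of A B] vP by (simp add: AB)
    then obtain a b L where A: "A = a # b # L"
      by (metis Suc_le_length_iff numeral_2_eq_2)
    have "2 \<le> length (rev B)"
      using two_before[of "rev B" "rev A"] vP[unfolded AB] vpath_rev[of P] by (auto simp: AB)
    then obtain d c R where "rev B = d # c # R"
      by (metis Suc_le_length_iff numeral_2_eq_2)
    then have "P = (a # b # L) @ (v # rev R @ [c, d])"
      using AB A by simp
    \<comment> \<open>\<open>R\<close> is rebound to its reverse, so that \<open>P\<close> reads
      from left to right.\<close>
    then obtain R where P_eq: "P = (a # b # L) @ (v # R @ [c, d])" ..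
    have abL: "vpath (a # b # L) G" and vRcd: "vpath (v # R @ [c, d]) G"
      and disj: "set (a # b # L) \<inter> set (v # R @ [c, d]) = {}"
      using vP vpath_append_iff[of "a # b # L" "v # R @ [c, d]" G] unfolding P_eq by blast+
    have bL: "vpath (b # L) G" and "a \<rightarrow> b"
      using abL by (simp_all add: vpath_Cons_iff)
    have vRc: "vpath (v # R @ [c]) G" and "c \<rightarrow> d"
      using vRcd vpath_append_iff[of "v # R @ [c]" "[d]" G] by simp_all
    have end_free: "\<not> r \<rightarrow> a" "\<not> r \<rightarrow> d" if "r \<notin> set P" for r
      using longest_path_hd_free[OF P that] longest_path_hd_free[OF rev_P, of r] that
      by (simp_all add: P_eq)
    have second_free: "\<not> r \<rightarrow> b" "\<not> r \<rightarrow> c"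
      if "r \<notin> set P" "s \<notin> set P" "s \<rightarrow> r" for r s
      using longest_path_second_free[of a "tl P" r s] longest_path_second_free[of d "tl (rev P)" r s]
        P rev_P that by (simp_all add: P_eq)
    \<comment> \<open>The edge would join the two halves of \<open>P\<close> in the other order,
      freeing \<open>v\<close> to be preceded by \<open>y\<close>: one vertex more than
      \<open>P\<close>.\<close>
    have "\<not> a \<rightarrow> d"
    proof
      assume "a \<rightarrow> d"
      then have "vpath ((y # v # R @ [c, d]) @ (a # b # L)) G"
        using y_path[OF vRcd] abL xyv disj sym[of a d] by (subst vpath_append_iff) (auto simp: P_eq)
      from P_max[OF this] show False
        by (simp add: P_eq)
    qed
    \<comment> \<open>The same exchange loses \<open>d\<close> but gains both \<open>x\<close> and
      \<open>y\<close>; in the next case it loses \<open>a\<close> instead.\<close>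
    moreover have "\<not> a \<rightarrow> c"
    proof
      assume "a \<rightarrow> c"
      then have "vpath ((x # y # v # R @ [c]) @ (a # b # L)) G"
        using xy_path[OF vRc] abL xyv disj sym[of a c] by (subst vpath_append_iff) (auto simp: P_eq)
      from P_max[OF this] show False
        by (simp add: P_eq)
    qed
    moreover have "\<not> b \<rightarrow> d"
    proof
      assume "b \<rightarrow> d"
      then have "vpath ((x # y # v # R @ [c, d]) @ (b # L)) G"
        using xy_path[OF vRcd] bL xyv disj sym[of b d] by (subst vpath_append_iff) (auto simp: P_eq)
      from P_max[OF this] show False
        by (simp add: P_eq)
    qed
    moreover have xy_free: "\<not> s \<rightarrow> t" if "s \<in> {x, y}" "t \<in> {a, b, c, d}" for s t
    proof -
      have "t \<in> set P"
        using that(2) by (auto simp: P_eq)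
      then show ?thesis
        using that x end_free[OF xyv(2)] second_free[OF xyv(2,1,4)] by blast
    qed
    \<comment> \<open>This is the only adjacency left that can spoil the induced matching.\<close>
    ultimately have "b \<rightarrow> c"
      using not_induced_free_three_edges[of x y a b c d] assms(2) \<open>x \<rightarrow> y\<close> \<open>a \<rightarrow> b\<close> \<open>c \<rightarrow> d\<close>
      by blast
    \<comment> \<open>\<open>Q\<close> trades the ends \<open>a\<close>, \<open>d\<close> of
      \<open>P\<close> for \<open>x\<close>, \<open>y\<close>. Hence a vertex off \<open>Q\<close>
      is also off \<open>P\<close> unless it is \<open>a\<close> or \<open>d\<close>.\<close>
    define Q where "Q = (x # y # v # R @ [c]) @ (b # L)"
    have vQ: "vpath Q G"
      using xy_path[OF vRc] bL xyv disj sym[OF \<open>b \<rightarrow> c\<close>] unfolding Q_def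
      by (subst vpath_append_iff) (auto simp: P_eq)
    moreover have "length Q = length P"
      by (simp add: P_eq Q_def)
    ultimately have Q: "longest_path Q G"
      using P by (simp add: longest_path_def)
    have "dominating (set Q) G"
    proof (rule ccontr)
      assume "\<not> dominating (set Q) G"
      moreover have "set Q \<subseteq> verts G" "set Q \<noteq> {}"
        using vQ by (auto simp: vpath_iff_successively)
      ultimately obtain z w where zw: "z \<notin> set Q" "w \<notin> set Q" "z \<rightarrow> w"
        and z: "\<And>u. u \<in> set Q \<Longrightarrow> \<not> z \<rightarrow> u"
        using not_dominating_obtain[OF assms(1)] by metis
      have "b \<in> set Q" "c \<in> set Q" "x \<in> set Q" "y \<in> set Q"
        by (auto simp: Q_def)
      \<comment> \<open>\<open>a\<close> and \<open>d\<close> have the neighbours \<open>b\<close>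
        and \<open>c\<close> on \<open>Q\<close>, while \<open>z\<close> has none there.\<close>
      then have "z \<noteq> a" "z \<noteq> d"
        using z sym \<open>a \<rightarrow> b\<close> \<open>c \<rightarrow> d\<close> by blast+
      then have "z \<notin> set P"
        using zw(1) by (auto simp: P_eq Q_def)
      \<comment> \<open>As \<open>z\<close> is off \<open>P\<close>, it cannot be adjacent to an end
        of \<open>P\<close>.\<close>
      then have "w \<noteq> a" "w \<noteq> d"
        using zw(3) end_free by auto
      then have "w \<notin> set P"
        using zw(2) by (auto simp: P_eq Q_def)
      \<comment> \<open>\<open>x\<close>, \<open>y\<close> begin \<open>Q\<close> just as
        \<open>a\<close>, \<open>b\<close> begin \<open>P\<close>, so the maximality of each path
        separates \<open>w\<close> from one of the two edges.\<close>
      have "\<not> w \<rightarrow> x"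
        using longest_path_hd_free[OF Q zw(2)] by (simp add: Q_def)
      moreover have "\<not> w \<rightarrow> y"
        using longest_path_second_free[of x "tl Q" w z] Q zw by (simp add: Q_def)
      moreover have "\<not> w \<rightarrow> a" "\<not> w \<rightarrow> b" "\<not> z \<rightarrow> a" "\<not> z \<rightarrow> b" "\<not> z \<rightarrow> x" "\<not> z \<rightarrow> y"
        using end_free second_free[OF \<open>w \<notin> set P\<close> \<open>z \<notin> set P\<close> \<open>z \<rightarrow> w\<close>] z
          \<open>w \<notin> set P\<close> \<open>z \<notin> set P\<close> \<open>b \<in> set Q\<close> \<open>x \<in> set Q\<close> \<open>y \<in> set Q\<close> by auto
      ultimately show False
        using not_induced_free_three_edges[of z w x y a b] assms(2) xy_free
          \<open>z \<rightarrow> w\<close> \<open>x \<rightarrow> y\<close> \<open>a \<rightarrow> b\<close> by blast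
    qed
    with Q show ?thesis
      by blast
  qed (use P in blast)
qed

theorem theorem8:
  fixes G :: "('a, 'b) pre_digraph"
  assumes "graph G"
    and "Digraph_Component.connected G"
    and "induced_free (with_proj (disjoint_copies 3 (path_graph 2))) G"
  shows "\<exists>p. longest_path p G \<and> dominating (set p) G"
  using assms by (rule graph.dominating_longest_path_exists)

end
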